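(* Let $k$ be a kernel (symmetric, integrable, non-trivial, nonnegative, $k(0)=0$). Suppose that $u:[0,\infty)\times\mathbb{Z}\to(0,\infty)$ is $C^1$ in time and such that $\Upsilon\big(\log u(t,x+\cdot)-\log u(t,x)\big)\in\ell^1_k(\mathbb{Z})$ for all $t>0$ and $x\in\mathbb{Z}$. Suppose further that $$\partial_t\log u\ \ge\ \Psi_\Upsilon(\log u)-\varphi(t)\quad\text{on }(0,\infty)\times\mathbb{Z},$$ where $\varphi:(0,\infty)\to[0,\infty)$ is continuous. Let $0<t_1<t_2$ and $x_1,x_2\in\mathbb{Z}$. Then for every $N\in\mathbb{N}$ and every sequence of distinct points $(y_i)_{i=0,1,\dots,N}\subset\mathbb{Z}$ satisfying $y_0=x_1$, $y_N=x_2$ and $k(y_i-y_{i-1})>0$ for $i\in\{1,\dots,N\}$, there holds $$u(t_1,x_1)\ \le\ u(t_2,x_2)\,\exp\Big(\int_{t_1}^{t_2}\varphi(t)\,\mathrm{d}t+\frac{2N}{t_2-t_1}\sum_{i=1}^N\frac1{k(y_i-y_{i-1})}\Big).$$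
   Context: Kernel: $k:\mathbb{Z}\to[0,\infty)$ is not identically zero, $k(0)=0$, $k(j)=k(-j)$ for all $j$, and $\sum_{j\in\mathbb{Z}}k(j)<\infty$. $\ell^1_k(\mathbb{Z})=\{w:\mathbb{Z}\to\mathbb{R}:\sum_{j\in\mathbb{Z}}k(j)|w(j)|<\infty\}$. $\Upsilon(r)=e^r-1-r$, $r\in\mathbb{R}$, and $\Psi_\Upsilon(w)(x)=\sum_{y\in\mathbb{Z}}k(x-y)\Upsilon(w(y)-w(x))$, acting on the spatial variable for functions of $(t,x)$. $\mathbb{N}=\{1,2,\dots\}$. *)

theory Defs
  imports "HOL-Analysis.Analysis"
begin

definition is_kernel :: "(int \<Rightarrow> real) \<Rightarrow> bool" where
  "is_kernel k \<longleftrightarrow>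
     (\<forall>j. k j \<ge> 0) \<and> (\<exists>j. k j \<noteq> 0) \<and> k 0 = 0 \<and> (\<forall>j. k j = k (- j)) \<and> k summable_on UNIV"

definition ell1 :: "(int \<Rightarrow> real) \<Rightarrow> (int \<Rightarrow> real) set" where
  "ell1 k = {w. (\<lambda>j. k j * \<bar>w j\<bar>) summable_on UNIV}"

definition Upsilon :: "real \<Rightarrow> real" where
  "Upsilon r = exp r - 1 - r"

definition Psi_Upsilon :: "(int \<Rightarrow> real) \<Rightarrow> (int \<Rightarrow> real) \<Rightarrow> int \<Rightarrow> real" where
  "Psi_Upsilon k w x = (\<Sum>\<^sub>\<infinity>y. k (x - y) * Upsilon (w y - w x))"

text \<open>The library's \<open>C1_differentiable_on\<close> demands two-sided derivatives.  Here the derivative is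
  taken within the set, so that on \<open>{0..}\<close> it is one-sided at \<open>0\<close> and nothing depends on the values
  of the function at negative times.\<close>

definition C1_within :: "real set \<Rightarrow> (real \<Rightarrow> real) \<Rightarrow> bool" where
  "C1_within S f \<longleftrightarrow>
     (\<exists>f'. (\<forall>t\<in>S. (f has_real_derivative f' t) (at t within S)) \<and> continuous_on S f')"

end

theory Submission
  imports Defs
begin

text \<open>
  Pass to \<open>v = ln u\<close> and absorb the error term into \<open>w(t,x) = v(t,x) + \<integral>\<^sub>a\<^sup>t \<phi>\<close>.  All terms of
  \<open>\<Psi>\<^sub>\<Upsilon>\<close> are nonnegative, because \<open>\<Upsilon> \<ge> 0\<close>.  So the differential inequality has two consequences:
  every \<open>w(\<cdot>,x)\<close> is nondecreasing, and along an edge from \<open>x\<close> to \<open>x'\<close> with weight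
  \<open>\<kappa> = k(x' - x) > 0\<close> a single term of the sum survives,
  \<open>\<partial>\<^sub>t w(t,x') \<ge> \<kappa> \<Upsilon>(w(t,x) - w(t,x'))\<close>.

  Fix the value \<open>w(a,x)\<close> and consider the deficit \<open>d(t) = w(a,x) - w(t,x')\<close>.  As long as \<open>d\<close> is
  positive, monotonicity in time gives \<open>w(t,x) - w(t,x') \<ge> d(t) > 0\<close>, and
  \<open>\<Upsilon>(r) \<ge> r\<^sup>2/2\<close> for \<open>r \<ge> 0\<close> turns the edge inequality into the Riccati inequality
  \<open>d' \<le> - \<kappa> d\<^sup>2/2\<close>.  Its solutions satisfy \<open>d(b) \<le> 2/(\<kappa> (b - a))\<close> whatever the
  initial value was; this is the Harnack estimate for one edge (\<open>one_edge_estimate\<close>).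

  For a path with \<open>N\<close> edges, divide \<open>[t\<^sub>1,t\<^sub>2]\<close> into \<open>N\<close> intervals of equal length, spend one
  on each edge, and add the estimates for \<open>v\<close>; then exponentiate.
\<close>

lemma Upsilon_nonneg: "Upsilon r \<ge> 0"
  using exp_ge_add_one_self[of r] unfolding Upsilon_def by linarith

lemma Upsilon_ge_half_square: "r \<ge> 0 \<Longrightarrow> Upsilon r \<ge> r\<^sup>2 / 2"
  using exp_lower_Taylor_quadratic[of r] by (simp add: Upsilon_def)

text \<open>The \<open>\<ell>\<^sup>1\<close> condition is what excludes the default value \<open>0\<close> that an infinite sum
  takes when its terms are not summable; for summable nonnegative terms, the sum
  dominates each of them.\<close>

lemma Psi_Upsilon_ge_term:
  assumes "is_kernel k" and "(\<lambda>j. Upsilon (w (x + j) - w x)) \<in> ell1 k"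
  shows "Psi_Upsilon k w x \<ge> k (x - z) * Upsilon (w z - w x)"
proof -
  have k_nonneg: "k j \<ge> 0" and k_sym: "k (- j) = k j" for j
    using assms(1) unfolding is_kernel_def by metis+
  let ?F = "\<lambda>z. k (x - z) * Upsilon (w z - w x)"
  have "(\<lambda>j. k j * Upsilon (w (x + j) - w x)) summable_on UNIV"
    using assms(2) by (simp add: ell1_def Upsilon_nonneg)
  moreover have "(\<lambda>j. ?F (x + j)) = (\<lambda>j. k j * Upsilon (w (x + j) - w x))"
    using k_sym by simp
  moreover have "bij_betw (\<lambda>j. x + j) UNIV (UNIV :: int set)"
    by (rule bij_betw_byWitness[where f' = "\<lambda>z. z - x"]) auto
  ultimately have summable: "?F summable_on UNIV"
    using summable_on_reindex_bij_betw[of "\<lambda>j. x + j" UNIV UNIV ?F] by simp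
  have "infsum ?F {z} \<le> infsum ?F UNIV"
    by (rule infsum_mono_neutral) (use summable k_nonneg Upsilon_nonneg in auto)
  then show ?thesis
    by (simp add: Psi_Upsilon_def)
qed

text \<open>The function \<open>1/d - c t\<close> is nondecreasing, and discarding \<open>1/d(a) > 0\<close> leaves a bound
  that does not depend on the initial value.\<close>

lemma riccati_decay:
  fixes d d' :: "real \<Rightarrow> real"
  assumes "a < b" and "c > 0" and cont: "continuous_on {a..b} d"
    and pos: "\<And>t. a \<le> t \<Longrightarrow> t \<le> b \<Longrightarrow> d t > 0"
    and deriv: "\<And>t. a < t \<Longrightarrow> t < b \<Longrightarrow> (d has_real_derivative d' t) (at t)"
    and riccati: "\<And>t. a < t \<Longrightarrow> t < b \<Longrightarrow> d' t \<le> - (c * (d t)\<^sup>2)"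
  shows "d b \<le> 1 / (c * (b - a))"
proof -
  have "1 / d a - c * a \<le> 1 / d b - c * b"
  proof (rule DERIV_nonneg_imp_increasing_open[where f = "\<lambda>t. 1 / d t - c * t"])
    show "a \<le> b"
      using \<open>a < b\<close> by simp
    show "continuous_on {a..b} (\<lambda>t. 1 / d t - c * t)"
      by (intro continuous_intros cont) (use pos in force)
    fix t assume t: "a < t" "t < b"
    then have "d t > 0"
      using pos by simp
    then have "((\<lambda>t. 1 / d t - c * t) has_real_derivative - d' t / (d t)\<^sup>2 - c) (at t)"
      by (auto intro!: derivative_eq_intros deriv[OF t] simp: power2_eq_square)
    moreover have "- d' t / (d t)\<^sup>2 - c \<ge> 0"
      using riccati[OF t] \<open>d t > 0\<close> by (simp add: field_simps)
    ultimately show "\<exists>y. ((\<lambda>t. 1 / d t - c * t) has_real_derivative y) (at t) \<and> y \<ge> 0"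
      by blast
  qed
  moreover have "d a > 0" "d b > 0"
    using pos \<open>a < b\<close> by auto
  ultimately have "c * (b - a) \<le> 1 / d b"
    using zero_less_divide_1_iff[of "d a"] unfolding right_diff_distrib by linarith
  moreover have "c * (b - a) > 0"
    using \<open>a < b\<close> \<open>c > 0\<close> by simp
  ultimately show ?thesis
    using \<open>d b > 0\<close> by (simp add: field_simps)
qed

text \<open>Here \<open>f\<close> and \<open>g\<close> stand for \<open>ln u\<close> at the two ends of an edge of weight \<open>\<kappa>\<close>.\<close>

lemma one_edge_estimate:
  fixes f g f' g' \<phi> :: "real \<Rightarrow> real"
  assumes "a < b" and "\<kappa> > 0" and cont\<phi>: "continuous_on {a..b} \<phi>"
    and f: "\<And>t. a \<le> t \<Longrightarrow> t \<le> b \<Longrightarrow> (f has_real_derivative f' t) (at t)"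
    and g: "\<And>t. a \<le> t \<Longrightarrow> t \<le> b \<Longrightarrow> (g has_real_derivative g' t) (at t)"
    and f': "\<And>t. a \<le> t \<Longrightarrow> t \<le> b \<Longrightarrow> f' t \<ge> - \<phi> t"
    and g': "\<And>t. a \<le> t \<Longrightarrow> t \<le> b \<Longrightarrow> g' t \<ge> \<kappa> * Upsilon (f t - g t) - \<phi> t"
  shows "f a \<le> g b + integral {a..b} \<phi> + 2 / (\<kappa> * (b - a))"
proof -
  define I where "I t = integral {a..t} \<phi>" for t
  have I_within: "(I has_real_derivative \<phi> t) (at t within {a..b})" if "t \<in> {a..b}" for t
    unfolding I_def by (rule integral_has_real_derivative[OF cont\<phi> that])
  have I: "(I has_real_derivative \<phi> t) (at t)" if "a < t" "t < b" for t
    using I_within[of t] that by (simp add: at_within_Icc_at)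
  have contI: "continuous_on {a..b} I"
    using I_within by (rule DERIV_continuous_on)
  have contf: "continuous_on {a..b} f" and contg: "continuous_on {a..b} g"
    using f g by (auto intro!: DERIV_atLeastAtMost_imp_continuous_on)
  have fI_mono: "f a \<le> f t + I t" if "a \<le> t" "t \<le> b" for t
  proof -
    have "f a + I a \<le> f t + I t"
    proof (rule DERIV_nonneg_imp_increasing_open[where f = "\<lambda>t. f t + I t"])
      show "continuous_on {a..t} (\<lambda>t. f t + I t)"
        by (rule continuous_on_subset[where s = "{a..b}"])
           (use contf contI that in \<open>auto intro: continuous_intros\<close>)
      fix s assume s: "a < s" "s < t"
      then have "((\<lambda>t. f t + I t) has_real_derivative f' s + \<phi> s) (at s)"
        using that by (intro DERIV_add f I) auto
      moreover have "f' s + \<phi> s \<ge> 0"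
        using f'[of s] s that by simp
      ultimately show "\<exists>y. ((\<lambda>t. f t + I t) has_real_derivative y) (at s) \<and> y \<ge> 0"
        by blast
    qed (use that in simp)
    then show ?thesis by (simp add: I_def)
  qed
  define d where "d t = f a - (g t + I t)" for t
  have d: "(d has_real_derivative - (g' t + \<phi> t)) (at t)" if "a < t" "t < b" for t
    unfolding d_def using that by (auto intro!: derivative_eq_intros g I)
  have contd: "continuous_on {a..b} d"
    unfolding d_def by (intro continuous_intros contg contI)
  \<comment> \<open>So positivity of \<open>d\<close> at the end point \<open>b\<close> carries back to all of \<open>[a,b]\<close>.\<close>
  have d_antimono: "d b \<le> d t" if "a \<le> t" "t \<le> b" for t
  proof -
    have "- d t \<le> - d b"
    proof (rule DERIV_nonneg_imp_increasing_open[where f = "\<lambda>t. - d t"])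
      show "continuous_on {t..b} (\<lambda>t. - d t)"
        by (rule continuous_on_subset[where s = "{a..b}"])
           (use contd that in \<open>auto intro: continuous_intros\<close>)
      fix s assume s: "t < s" "s < b"
      then have "((\<lambda>t. - d t) has_real_derivative g' s + \<phi> s) (at s)"
        using that DERIV_minus[OF d[of s]] by (simp add: add.commute)
      moreover have "\<kappa> * Upsilon (f s - g s) \<ge> 0"
        using \<open>\<kappa> > 0\<close> by (simp add: Upsilon_nonneg)
      then have "g' s + \<phi> s \<ge> 0"
        using g'[of s] s that by simp
      ultimately show "\<exists>y. ((\<lambda>t. - d t) has_real_derivative y) (at s) \<and> y \<ge> 0"
        by blast
    qed (use that in simp)
    then show ?thesis by simp
  qed
  have "d b \<le> 2 / (\<kappa> * (b - a))"
  proof (cases "d b > 0")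
    case True
    have "d b \<le> 1 / (\<kappa> / 2 * (b - a))"
    proof (rule riccati_decay[where d' = "\<lambda>t. - (g' t + \<phi> t)"])
      show "d t > 0" if "a \<le> t" "t \<le> b" for t
        using d_antimono[OF that] True by simp
      fix t assume t: "a < t" "t < b"
      have "0 \<le> d t" "d t \<le> f t - g t"
        using d_antimono[of t] fI_mono[of t] t True by (auto simp: d_def)
      then have "(d t)\<^sup>2 / 2 \<le> Upsilon (f t - g t)"
        using power_mono[of "d t" "f t - g t" 2] Upsilon_ge_half_square[of "f t - g t"]
        by linarith
      then have "\<kappa> * ((d t)\<^sup>2 / 2) \<le> \<kappa> * Upsilon (f t - g t)"
        using \<open>\<kappa> > 0\<close> by (intro mult_left_mono) auto
      then show "- (g' t + \<phi> t) \<le> - (\<kappa> / 2 * (d t)\<^sup>2)"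
        using g'[of t] t by simp
    qed (use assms(1,2) contd d in auto)
    then show ?thesis by simp
  next
    case False
    moreover have "2 / (\<kappa> * (b - a)) > 0"
      using assms(1,2) by simp
    ultimately show ?thesis by linarith
  qed
  then show ?thesis by (simp add: d_def I_def)
qed

theorem theorem6p1:
  fixes k :: "int \<Rightarrow> real" and u :: "real \<Rightarrow> int \<Rightarrow> real" and \<phi> :: "real \<Rightarrow> real"
    and t1 t2 :: real and x1 x2 :: int and N :: nat and y :: "nat \<Rightarrow> int"
  assumes "is_kernel k"
    and "\<And>t x. t \<ge> 0 \<Longrightarrow> u t x > 0"
    and "\<And>x. C1_within {0..} (\<lambda>t. u t x)"
    and "\<And>t x. t > 0 \<Longrightarrow> (\<lambda>j. Upsilon (ln (u t (x + j)) - ln (u t x))) \<in> ell1 k"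
    and "\<And>t x. t > 0 \<Longrightarrow>
           deriv (\<lambda>s. ln (u s x)) t \<ge> Psi_Upsilon k (\<lambda>z. ln (u t z)) x - \<phi> t"
    and "continuous_on {0<..} \<phi>"
    and "\<And>t. t > 0 \<Longrightarrow> \<phi> t \<ge> 0"
    and "0 < t1" and "t1 < t2"
    and "N \<ge> 1"
    and "inj_on y {0..N}"
    and "y 0 = x1" and "y N = x2"
    and "\<And>i. i \<in> {1..N} \<Longrightarrow> k (y i - y (i - 1)) > 0"
  shows "u t1 x1 \<le> u t2 x2 *
           exp (integral {t1..t2} \<phi>
                + 2 * real N / (t2 - t1) * (\<Sum>i = 1..N. 1 / k (y i - y (i - 1))))"
proof -
  define v where "v t x = ln (u t x)" for t x
  define v' where "v' t x = deriv (\<lambda>s. v s x) t" for t x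
  have v_deriv: "((\<lambda>s. v s x) has_real_derivative v' t x) (at t)" if "t > 0" for t x
  proof -
    obtain u' where "\<forall>t\<in>{0..}. ((\<lambda>s. u s x) has_real_derivative u' t) (at t within {0..})"
      using assms(3)[of x] unfolding C1_within_def by blast
    then have "((\<lambda>s. u s x) has_real_derivative u' t) (at t within {0..})"
      using that by simp
    moreover have "at t within {0..} = at t"
      using that by (intro at_within_interior) simp
    ultimately have "((\<lambda>s. v s x) has_real_derivative 1 / u t x * u' t) (at t)"
      using assms(2)[of t x] that unfolding v_def
      by (auto intro!: derivative_eq_intros)
    then show ?thesis
      unfolding v'_def using DERIV_imp_deriv by metis
  qed
  have v'_ge: "v' t x \<ge> k (x - z) * Upsilon (v t z - v t x) - \<phi> t" if "t > 0" for t x z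
    using assms(5)[OF that, of x]
      Psi_Upsilon_ge_term[OF assms(1), of "\<lambda>z. ln (u t z)" x z] assms(4)[OF that, of x]
    by (simp add: v_def v'_def)
  define \<tau> where "\<tau> n = t1 + real n * ((t2 - t1) / real N)" for n
  have \<tau>_step: "\<tau> (Suc n) - \<tau> n = (t2 - t1) / real N" for n
    by (simp add: \<tau>_def algebra_simps add_divide_distrib diff_divide_distrib)
  have step_pos: "(t2 - t1) / real N > 0"
    using assms(9,10) by simp
  have \<tau>_ge: "\<tau> n \<ge> t1" for n
    using mult_nonneg_nonneg[of "real n" "(t2 - t1) / real N"] step_pos by (simp add: \<tau>_def)
  have cont: "continuous_on {s..t} \<phi>" if "s > 0" for s t
    by (rule continuous_on_subset[OF assms(6)]) (use that in auto)
  have path: "v t1 (y 0) \<le> v (\<tau> n) (y n) + integral {t1..\<tau> n} \<phi>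
       + 2 * real N / (t2 - t1) * (\<Sum>i = 1..n. 1 / k (y i - y (i - 1)))" if "n \<le> N" for n
    using that
  proof (induction n)
    case 0
    then show ?case by (simp add: \<tau>_def)
  next
    case (Suc n)
    let ?\<kappa> = "k (y (Suc n) - y n)"
    have \<kappa>_pos: "?\<kappa> > 0"
      using assms(14)[of "Suc n"] Suc.prems by simp
    have \<tau>_less: "\<tau> n < \<tau> (Suc n)"
      using \<tau>_step[of n] step_pos by simp
    have \<tau>_pos: "\<tau> n > 0"
      using \<tau>_ge[of n] assms(8) by simp
    have "v (\<tau> n) (y n) \<le> v (\<tau> (Suc n)) (y (Suc n)) + integral {\<tau> n..\<tau> (Suc n)} \<phi>
        + 2 / (?\<kappa> * (\<tau> (Suc n) - \<tau> n))"
    proof (rule one_edge_estimate[where f = "\<lambda>t. v t (y n)" and g = "\<lambda>t. v t (y (Suc n))"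
          and f' = "\<lambda>t. v' t (y n)" and g' = "\<lambda>t. v' t (y (Suc n))"])
      fix t assume t: "\<tau> n \<le> t" "t \<le> \<tau> (Suc n)"
      then have "t > 0" using \<tau>_pos by simp
      (* The term at z = x itself vanishes and leaves only -\<phi>. *)
      then show "v' t (y n) \<ge> - \<phi> t"
        using v'_ge[of t "y n" "y n"] by (simp add: Upsilon_def)
      show "v' t (y (Suc n)) \<ge> ?\<kappa> * Upsilon (v t (y n) - v t (y (Suc n))) - \<phi> t"
        using v'_ge \<open>t > 0\<close> by blast
    qed (use \<tau>_less \<kappa>_pos \<tau>_pos cont v_deriv in auto)
    also have "2 / (?\<kappa> * (\<tau> (Suc n) - \<tau> n)) = 2 * real N / (t2 - t1) * (1 / ?\<kappa>)"
      by (simp add: \<tau>_step)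
    finally have edge: "v (\<tau> n) (y n) \<le> v (\<tau> (Suc n)) (y (Suc n))
        + integral {\<tau> n..\<tau> (Suc n)} \<phi> + 2 * real N / (t2 - t1) * (1 / ?\<kappa>)" .
    have "integral {t1..\<tau> n} \<phi> + integral {\<tau> n..\<tau> (Suc n)} \<phi> = integral {t1..\<tau> (Suc n)} \<phi>"
      by (rule Henstock_Kurzweil_Integration.integral_combine)
         (use \<tau>_ge \<tau>_less assms(8) cont in \<open>auto intro!: integrable_continuous_interval\<close>)
    then show ?case
      using Suc edge by (simp add: distrib_left)
  qed
  have "\<tau> N = t2"
    using assms(10) by (simp add: \<tau>_def)
  then have "ln (u t1 x1) \<le> ln (u t2 x2) + (integral {t1..t2} \<phi>
       + 2 * real N / (t2 - t1) * (\<Sum>i = 1..N. 1 / k (y i - y (i - 1))))"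
    (is "_ \<le> _ + ?E")
    using path[of N] assms(12,13) by (simp add: v_def)
  moreover have "u t1 x1 > 0" "u t2 x2 > 0"
    using assms(2,8,9) by auto
  ultimately have "u t1 x1 \<le> exp (ln (u t2 x2) + ?E)"
    using ln_le_cancel_iff[of "u t1 x1" "exp (ln (u t2 x2) + ?E)"] by simp
  then show ?thesis
    using \<open>u t2 x2 > 0\<close> by (simp add: exp_add)
qed

end
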